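(* Let $n_1,n_2$ be even positive integers, $n_3$ a positive integer, $\mathcal{A}\in\mathbb{R}^{n_1\times n_2\times n_3}$, and $$L_1=\max_{i,j,k}|\mathcal{A}(i+1,j,k)-\mathcal{A}(i,j,k)|,\quad L_2=\max_{i,j,k}|\mathcal{A}(i,j+1,k)-\mathcal{A}(i,j,k)|,\quad L_3=\max_{i,j,k}|\mathcal{A}(i,j,k+1)-\mathcal{A}(i,j,k)|.$$ Let $[\mathcal{B}_1,\mathcal{B}_2;\mathcal{B}_3,\mathcal{B}_4]=\mathrm{HWT}(\mathcal{A})$. Then the following bounds hold. (Dimension $x$) $$\max_{i,j,k}|\mathcal{B}_1(i+1,j,k)-\mathcal{B}_1(i,j,k)|\le 4L_1,$$ $$\max_{i,j,k}|\mathcal{B}_2(i+1,j,k)-\mathcal{B}_2(i,j,k)|\le 2\min(2L_1,L_2),$$ $$\max_{i,j,k}|\mathcal{B}_3(i+1,j,k)-\mathcal{B}_3(i,j,k)|\le 2L_1,$$ $$\max_{i,j,k}|\mathcal{B}_4(i+1,j,k)-\mathcal{B}_4(i,j,k)|\le 2\min(L_1,L_2).$$ (Dimension $y$) $$\max_{i,j,k}|\mathcal{B}_1(i,j+1,k)-\mathcal{B}_1(i,j,k)|\le 4L_2,$$ $$\max_{i,j,k}|\mathcal{B}_2(i,j+1,k)-\mathcal{B}_2(i,j,k)|\le 2L_2,$$ $$\max_{i,j,k}|\mathcal{B}_3(i,j+1,k)-\mathcal{B}_3(i,j,k)|\le 2\min(L_1,2L_2),$$ $$\max_{i,j,k}|\mathcal{B}_4(i,j+1,k)-\mathcal{B}_4(i,j,k)|\le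 2\min(L_1,L_2).$$ (Dimension $z$) $$\max_{i,j,k}|\mathcal{B}_s(i,j,k+1)-\mathcal{B}_s(i,j,k)|\le 2L_3,\quad s=1,2,3,4.$$ Moreover, all the upper bounds in these inequalities for the dimensions $x$, $y$ and $z$ are optimal: for each of these inequalities and for any $\epsilon>0$ there exists a tensor $\mathcal{A}\in\mathbb{R}^{n_1\times n_2\times n_3}$, with $n_1,n_2$ even positive integers and $n_3$ a positive integer (with its corresponding $L_1,L_2,L_3$ and $[\mathcal{B}_1,\mathcal{B}_2;\mathcal{B}_3,\mathcal{B}_4]=\mathrm{HWT}(\mathcal{A})$), for which the left-hand side is strictly greater than the right-hand side minus $\epsilon$; e.g. for the first inequality, $\max_{i,j,k}|\mathcal{B}_1(i+1,j,k)-\mathcal{B}_1(i,j,k)|>4L_1-\epsilon$.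
   Context: All maxima are over those indices for which every entry involved is defined. Haar wavelet transform (HWT): for even $n$, let $\boldsymbol{H}_{n/2},\boldsymbol{G}_{n/2}\in\mathbb{R}^{\frac n2\times n}$ be the matrices whose only nonzero entries are $\boldsymbol{H}_{n/2}(i,2i-1)=\boldsymbol{H}_{n/2}(i,2i)=\frac{\sqrt2}{2}$ and $\boldsymbol{G}_{n/2}(i,2i-1)=\frac{\sqrt2}{2}$, $\boldsymbol{G}_{n/2}(i,2i)=-\frac{\sqrt2}{2}$, $i=1,\dots,\frac n2$. For $\mathcal{A}\in\mathbb{R}^{n_1\times n_2\times n_3}$, $\mathrm{HWT}(\mathcal{A})=[\mathcal{B}_1,\mathcal{B}_2;\mathcal{B}_3,\mathcal{B}_4]$ consists of four tensors of size $\frac{n_1}2\times\frac{n_2}2\times n_3$ defined slice-wise: for each $k$, with $\boldsymbol{A}=\mathcal{A}(:,:,k)$: $\mathcal{B}_1(:,:,k)=\boldsymbol{H}_{n_1/2}\boldsymbol{A}\boldsymbol{H}_{n_2/2}^T$, $\mathcal{B}_2(:,:,k)=\boldsymbol{H}_{n_1/2}\boldsymbol{A}\boldsymbol{G}_{n_2/2}^T$, $\mathcal{B}_3(:,:,k)=\boldsymbol{G}_{n_1/2}\boldsymbol{A}\boldsymbol{H}_{n_2/2}^T$, $\mathcal{B}_4(:,:,k)=\boldsymbol{G}_{n_1/2}\boldsymbol{A}\boldsymbol{G}_{n_2/2}^T$. *)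

theory Defs
  imports Complex_Main "Jordan_Normal_Form.Matrix"
begin

text \<open>A third-order tensor is the list of its frontal slices; all indices are 0-based.\<close>

type_synonym tensor = "real mat list"

definition carrier_tensor :: "nat \<Rightarrow> nat \<Rightarrow> nat \<Rightarrow> tensor set" where
  "carrier_tensor n1 n2 n3 = {A. length A = n3 \<and> set A \<subseteq> carrier_mat n1 n2}"

definition entry :: "tensor \<Rightarrow> nat \<Rightarrow> nat \<Rightarrow> nat \<Rightarrow> real" where
  "entry A i j k = (A ! k) $$ (i, j)"

text \<open>Columns \<open>2 * i\<close> and \<open>2 * i + 1\<close> are columns \<open>2i - 1\<close> and \<open>2i\<close> of the usual 1-based description.\<close>

definition haar_H :: "nat \<Rightarrow> real mat" where
  "haar_H m = mat m (2 * m) (\<lambda>(i, j). if j = 2 * i \<or> j = 2 * i + 1 then sqrt 2 / 2 else 0)"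

definition haar_G :: "nat \<Rightarrow> real mat" where
  "haar_G m = mat m (2 * m)
     (\<lambda>(i, j). if j = 2 * i then sqrt 2 / 2 else if j = 2 * i + 1 then - (sqrt 2 / 2) else 0)"

definition haar_block :: "(nat \<Rightarrow> real mat) \<Rightarrow> (nat \<Rightarrow> real mat) \<Rightarrow> tensor \<Rightarrow> tensor" where
  "haar_block P Q A =
     map (\<lambda>M. P (dim_row M div 2) * M * transpose_mat (Q (dim_col M div 2))) A"

text \<open>\<open>HWT1\<close> to \<open>HWT4\<close> are the four blocks of \<open>HWT(A) = [B1, B2; B3, B4]\<close>.\<close>

definition HWT1 :: "tensor \<Rightarrow> tensor" where "HWT1 = haar_block haar_H haar_H"
definition HWT2 :: "tensor \<Rightarrow> tensor" where "HWT2 = haar_block haar_H haar_G"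
definition HWT3 :: "tensor \<Rightarrow> tensor" where "HWT3 = haar_block haar_G haar_H"
definition HWT4 :: "tensor \<Rightarrow> tensor" where "HWT4 = haar_block haar_G haar_G"

definition hwt_input :: "nat \<Rightarrow> nat \<Rightarrow> nat \<Rightarrow> tensor \<Rightarrow> bool" where
  "hwt_input n1 n2 n3 A \<longleftrightarrow>
     even n1 \<and> 0 < n1 \<and> even n2 \<and> 0 < n2 \<and> 0 < n3 \<and> A \<in> carrier_tensor n1 n2 n3"

text \<open>The positions at which both entries of a forward difference are defined. These sets
  can be empty (a block with a single row, say, or a tensor with a single slice).\<close>

definition idx_x :: "tensor \<Rightarrow> (nat \<times> nat \<times> nat) set" where
  "idx_x A = {(i, j, k). k < length A \<and> i + 1 < dim_row (A ! k) \<and> j < dim_col (A ! k)}"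

definition idx_y :: "tensor \<Rightarrow> (nat \<times> nat \<times> nat) set" where
  "idx_y A = {(i, j, k). k < length A \<and> i < dim_row (A ! k) \<and> j + 1 < dim_col (A ! k)}"

definition idx_z :: "tensor \<Rightarrow> (nat \<times> nat \<times> nat) set" where
  "idx_z A = {(i, j, k). k + 1 < length A
     \<and> i < dim_row (A ! k) \<and> j < dim_col (A ! k)
     \<and> i < dim_row (A ! (k + 1)) \<and> j < dim_col (A ! (k + 1))}"

text \<open>Only used for nonnegative \<open>f\<close>, so the maximum over the empty set is taken to be 0.\<close>

definition max_over :: "'a set \<Rightarrow> ('a \<Rightarrow> real) \<Rightarrow> real" where
  "max_over I f = (if I = {} then 0 else Max (f ` I))"

definition maxdiff_x :: "tensor \<Rightarrow> real" where
  "maxdiff_x A = max_over (idx_x A) (\<lambda>(i, j, k). \<bar>entry A (i + 1) j k - entry A i j k\<bar>)"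

definition maxdiff_y :: "tensor \<Rightarrow> real" where
  "maxdiff_y A = max_over (idx_y A) (\<lambda>(i, j, k). \<bar>entry A i (j + 1) k - entry A i j k\<bar>)"

definition maxdiff_z :: "tensor \<Rightarrow> real" where
  "maxdiff_z A = max_over (idx_z A) (\<lambda>(i, j, k). \<bar>entry A i j (k + 1) - entry A i j k\<bar>)"

end

theory Submission
  imports Defs
begin

text \<open>An entry of a block of \<open>HWT(A)\<close> is half a signed sum over a \<open>2 \<times> 2\<close> cell of a slice of \<open>A\<close>. For
  a forward difference along \<open>z\<close>, the four entries of a cell move by one step each. Along \<open>x\<close> or \<open>y\<close>
  two adjacent cells are involved: if the signs alternate along a direction, the entries of each cell
  are paired along that direction, at the cost of one step per pair; otherwise each entry is paired
  with its counterpart in the other cell, two steps away. The zero tensor attains every bound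
  trivially; the witnesses chosen for optimality attain them with nonzero values.\<close>

section \<open>Index sets and maximal forward differences\<close>

lemma carrier_tensorD:
  assumes "A \<in> carrier_tensor n1 n2 n3"
  shows "length A = n3"
    and "k < n3 \<Longrightarrow> A ! k \<in> carrier_mat n1 n2"
    and "k < n3 \<Longrightarrow> dim_row (A ! k) = n1"
    and "k < n3 \<Longrightarrow> dim_col (A ! k) = n2"
proof -
  show "length A = n3"
    using assms by (simp add: carrier_tensor_def)
  show slice: "A ! k \<in> carrier_mat n1 n2" if "k < n3"
    using assms nth_mem[of k A] that by (auto simp: carrier_tensor_def)
  show "dim_row (A ! k) = n1" and "dim_col (A ! k) = n2" if "k < n3"
    using slice[OF that] by auto
qed

lemma idx_eq:
  assumes "A \<in> carrier_tensor n1 n2 n3"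
  shows "idx_x A = {(i, j, k). i + 1 < n1 \<and> j < n2 \<and> k < n3}"
    and "idx_y A = {(i, j, k). i < n1 \<and> j + 1 < n2 \<and> k < n3}"
    and "idx_z A = {(i, j, k). i < n1 \<and> j < n2 \<and> k + 1 < n3}"
  using carrier_tensorD[OF assms] by (auto simp: idx_x_def idx_y_def idx_z_def)

lemma finite_idx:
  assumes "A \<in> carrier_tensor n1 n2 n3"
  shows "finite (idx_x A)" and "finite (idx_y A)" and "finite (idx_z A)"
  by (rule finite_subset[of _ "{..<n1} \<times> {..<n2} \<times> {..<n3}"];
      force simp: idx_eq[OF assms])+

text \<open>A bound on every value bounds their maximum. The assumption \<open>0 \<le> c\<close>
  takes care of the empty index set, over which \<open>max_over\<close> is 0 by convention.\<close>

lemma max_over_le: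
  assumes "finite I" and "0 \<le> c" and "\<And>p. p \<in> I \<Longrightarrow> f p \<le> c"
  shows "max_over I f \<le> c"
  using assms by (auto simp: max_over_def)

lemma max_over_ge:
  assumes "finite I" and "p \<in> I"
  shows "f p \<le> max_over I f"
  using assms by (auto simp: max_over_def)

lemma max_over_nonneg:
  assumes "finite I" and "\<And>p. 0 \<le> f p"
  shows "0 \<le> max_over I f"
proof (cases "I = {}")
  case False
  then obtain p where "p \<in> I" by blast
  then show ?thesis
    using max_over_ge[OF assms(1), of p f] assms(2)[of p] by linarith
qed (simp add: max_over_def)

lemma maxdiff_nonneg:
  assumes "A \<in> carrier_tensor n1 n2 n3"
  shows "0 \<le> maxdiff_x A" and "0 \<le> maxdiff_y A" and "0 \<le> maxdiff_z A"
  unfolding maxdiff_x_def maxdiff_y_def maxdiff_z_def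
  by (rule max_over_nonneg; use finite_idx[OF assms] in auto)+

text \<open>The way from bounds on single differences to bounds on the maxima, used for the blocks
  as well as for the explicit tensors. Again \<open>0 \<le> c\<close> covers tensors too thin to
  have a difference in the given direction.\<close>

lemma maxdiff_le:
  assumes "A \<in> carrier_tensor n1 n2 n3" and "0 \<le> c"
  shows "(\<And>i j k. i + 1 < n1 \<Longrightarrow> j < n2 \<Longrightarrow> k < n3 \<Longrightarrow>
            \<bar>entry A (i + 1) j k - entry A i j k\<bar> \<le> c) \<Longrightarrow> maxdiff_x A \<le> c"
    and "(\<And>i j k. i < n1 \<Longrightarrow> j + 1 < n2 \<Longrightarrow> k < n3 \<Longrightarrow>
            \<bar>entry A i (j + 1) k - entry A i j k\<bar> \<le> c) \<Longrightarrow> maxdiff_y A \<le> c"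
    and "(\<And>i j k. i < n1 \<Longrightarrow> j < n2 \<Longrightarrow> k + 1 < n3 \<Longrightarrow>
            \<bar>entry A i j (k + 1) - entry A i j k\<bar> \<le> c) \<Longrightarrow> maxdiff_z A \<le> c"
  unfolding maxdiff_x_def maxdiff_y_def maxdiff_z_def
  by (rule max_over_le[OF _ assms(2)]; use finite_idx[OF assms(1)] in \<open>auto simp: idx_eq[OF assms(1)]\<close>)+

lemma maxdiff_ge:
  assumes "A \<in> carrier_tensor n1 n2 n3"
  shows "i + 1 < n1 \<Longrightarrow> j < n2 \<Longrightarrow> k < n3 \<Longrightarrow>
           \<bar>entry A (i + 1) j k - entry A i j k\<bar> \<le> maxdiff_x A"
    and "i < n1 \<Longrightarrow> j + 1 < n2 \<Longrightarrow> k < n3 \<Longrightarrow>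
           \<bar>entry A i (j + 1) k - entry A i j k\<bar> \<le> maxdiff_y A"
    and "i < n1 \<Longrightarrow> j < n2 \<Longrightarrow> k + 1 < n3 \<Longrightarrow>
           \<bar>entry A i j (k + 1) - entry A i j k\<bar> \<le> maxdiff_z A"
  unfolding maxdiff_x_def maxdiff_y_def maxdiff_z_def
  using max_over_ge[OF finite_idx(1)[OF assms], of "(i, j, k)"
      "\<lambda>(i, j, k). \<bar>entry A (i + 1) j k - entry A i j k\<bar>"]
    max_over_ge[OF finite_idx(2)[OF assms], of "(i, j, k)"
      "\<lambda>(i, j, k). \<bar>entry A i (j + 1) k - entry A i j k\<bar>"]
    max_over_ge[OF finite_idx(3)[OF assms], of "(i, j, k)"
      "\<lambda>(i, j, k). \<bar>entry A i j (k + 1) - entry A i j k\<bar>"]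
  by (simp_all add: idx_eq[OF assms])

section \<open>Entries of the Haar blocks\<close>

definition haar :: "real \<Rightarrow> nat \<Rightarrow> real mat" where
  "haar s m = mat m (2 * m)
     (\<lambda>(i, j). if j = 2 * i then sqrt 2 / 2 else if j = 2 * i + 1 then s * (sqrt 2 / 2) else 0)"

text \<open>The averaging and the differencing matrix differ only in the sign of the second nonzero
  entry of each row. With this sign as a parameter, one entry formula serves all four
  blocks.\<close>

lemma haar_eqs: "haar_H = haar 1" "haar_G = haar (- 1)"
  by (auto simp: fun_eq_iff haar_H_def haar_G_def haar_def)

lemma HWT_eqs:
  "HWT1 = haar_block (haar 1) (haar 1)"
  "HWT2 = haar_block (haar 1) (haar (- 1))"
  "HWT3 = haar_block (haar (- 1)) (haar 1)"
  "HWT4 = haar_block (haar (- 1)) (haar (- 1))"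
  by (simp_all add: HWT1_def HWT2_def HWT3_def HWT4_def haar_eqs)

text \<open>Row \<open>i\<close> of \<open>haar s m\<close> is supported on the columns
  \<open>2 * i\<close> and \<open>2 * i + 1\<close>, so the sum collapses to two terms.\<close>

lemma sum_haar:
  fixes f :: "nat \<Rightarrow> real"
  assumes "i < m"
  shows "(\<Sum>p = 0..<2 * m. haar s m $$ (i, p) * f p) = sqrt 2 / 2 * (f (2 * i) + s * f (2 * i + 1))"
proof -
  have "(\<Sum>p = 0..<2 * m. haar s m $$ (i, p) * f p)
      = (\<Sum>p \<in> {2 * i, 2 * i + 1}. haar s m $$ (i, p) * f p)"
    using assms by (intro sum.mono_neutral_right) (auto simp: haar_def)
  also have "\<dots> = sqrt 2 / 2 * (f (2 * i) + s * f (2 * i + 1))"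
    using assms by (simp add: haar_def algebra_simps)
  finally show ?thesis .
qed

text \<open>The collapse to two terms is applied twice, first to the left factor and then to the
  right one. The sign \<open>s\<close> then weights the lower row of the cell and \<open>t\<close>
  its right column.\<close>

lemma haar_conj_entry:
  assumes "M \<in> carrier_mat (2 * m1) (2 * m2)" and "i < m1" and "j < m2"
  shows "(haar s m1 * M * transpose_mat (haar t m2)) $$ (i, j)
    = (M $$ (2 * i, 2 * j) + t * M $$ (2 * i, 2 * j + 1)
       + s * (M $$ (2 * i + 1, 2 * j) + t * M $$ (2 * i + 1, 2 * j + 1))) / 2"
proof -
  have [simp]: "dim_row (haar r m) = m" "dim_col (haar r m) = 2 * m" for r m
    by (auto simp: haar_def)
  have [simp]: "dim_row M = 2 * m1" "dim_col M = 2 * m2"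
    using assms(1) by auto
  \<comment> \<open>Each of the two factors contributes one normalisation \<open>sqrt 2 / 2\<close>;
    together they give the factor one half.\<close>
  have half: "sqrt 2 / 2 * (sqrt 2 / 2 * x) = x / 2" for x
    by simp
  have inner: "(haar s m1 * M) $$ (i, q) = sqrt 2 / 2 * (M $$ (2 * i, q) + s * M $$ (2 * i + 1, q))"
    if "q < 2 * m2" for q
    using that assms(2) sum_haar[OF assms(2), of s "\<lambda>p. M $$ (p, q)"]
    by (simp add: scalar_prod_def)
  \<comment> \<open>Because of the transpose, column \<open>j\<close> of the right factor is row
    \<open>j\<close> of \<open>haar t m2\<close>, so the sum again has the shape that
    \<open>sum_haar\<close> treats.\<close>
  have "(haar s m1 * M * transpose_mat (haar t m2)) $$ (i, j)
      = (\<Sum>q = 0..<2 * m2. haar t m2 $$ (j, q) * (haar s m1 * M) $$ (i, q))"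
    using assms(2,3) by (simp add: scalar_prod_def mult.commute)
  also have "\<dots> = sqrt 2 / 2 * ((haar s m1 * M) $$ (i, 2 * j) + t * (haar s m1 * M) $$ (i, 2 * j + 1))"
    by (rule sum_haar[OF assms(3)])
  also have "\<dots> = sqrt 2 / 2 * (sqrt 2 / 2
      * (M $$ (2 * i, 2 * j) + t * M $$ (2 * i, 2 * j + 1)
         + s * (M $$ (2 * i + 1, 2 * j) + t * M $$ (2 * i + 1, 2 * j + 1))))"
    using assms(3) by (simp add: inner algebra_simps)
  finally show ?thesis
    unfolding half .
qed

lemma haar_block_carrier:
  assumes "A \<in> carrier_tensor (2 * m1) (2 * m2) n3"
  shows "haar_block (haar s) (haar t) A \<in> carrier_tensor m1 m2 n3"
  using assms by (fastforce simp: carrier_tensor_def haar_block_def haar_def)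

lemma HWT_carrier:
  assumes "A \<in> carrier_tensor (2 * m1) (2 * m2) n3"
  shows "HWT1 A \<in> carrier_tensor m1 m2 n3" and "HWT2 A \<in> carrier_tensor m1 m2 n3"
    and "HWT3 A \<in> carrier_tensor m1 m2 n3" and "HWT4 A \<in> carrier_tensor m1 m2 n3"
  unfolding HWT_eqs by (rule haar_block_carrier[OF assms])+

lemma entry_haar_block:
  assumes "A \<in> carrier_tensor (2 * m1) (2 * m2) n3" and "i < m1" and "j < m2" and "k < n3"
  shows "entry (haar_block (haar s) (haar t) A) i j k
    = (entry A (2 * i) (2 * j) k + t * entry A (2 * i) (2 * j + 1) k
       + s * (entry A (2 * i + 1) (2 * j) k + t * entry A (2 * i + 1) (2 * j + 1) k)) / 2"
  using haar_conj_entry[OF carrier_tensorD(2)[OF assms(1,4)] assms(2,3), of s t]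
    carrier_tensorD(1,3,4)[OF assms(1)] assms(4)
  by (simp add: entry_def haar_block_def)

section \<open>Upper bounds for the differences in the blocks\<close>

lemma hwt_inputE:
  assumes "hwt_input n1 n2 n3 A"
  obtains m1 m2 where "A \<in> carrier_tensor (2 * m1) (2 * m2) n3"
  using assms by (auto simp: hwt_input_def elim!: evenE)

text \<open>Two cells adjacent along \<open>x\<close> form a window of four rows and two columns. In
  \<open>HWT1\<close> its eight entries form four pairs at distance two, which gives
  \<open>4 * 2 / 2 = 4\<close> steps along \<open>x\<close>; in \<open>HWT3\<close> the signs
  alternate along \<open>x\<close>, so four pairs of neighbours give \<open>4 / 2 = 2\<close> steps.
  In \<open>HWT2\<close> and \<open>HWT4\<close> the signs also alternate along \<open>y\<close>,
  and pairing within each of the four rows gives 2 steps along \<open>y\<close> as a second bound,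
  hence the minimum.\<close>

lemma maxdiff_x_HWT_entry_le:
  assumes A: "A \<in> carrier_tensor (2 * m1) (2 * m2) n3" and ijk: "i + 1 < m1" "j < m2" "k < n3"
  shows "\<bar>entry (HWT1 A) (i + 1) j k - entry (HWT1 A) i j k\<bar> \<le> 4 * maxdiff_x A"
    and "\<bar>entry (HWT2 A) (i + 1) j k - entry (HWT2 A) i j k\<bar> \<le> 2 * min (2 * maxdiff_x A) (maxdiff_y A)"
    and "\<bar>entry (HWT3 A) (i + 1) j k - entry (HWT3 A) i j k\<bar> \<le> 2 * maxdiff_x A"
    and "\<bar>entry (HWT4 A) (i + 1) j k - entry (HWT4 A) i j k\<bar> \<le> 2 * min (maxdiff_x A) (maxdiff_y A)"
proof -
  \<comment> \<open>The four rows of the window are joined by three steps in each of its two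
    columns; \<open>y\<close> below gives the single step across each row.\<close>
  have x: "\<bar>entry A (2 * i + r + 1) (2 * j + c) k - entry A (2 * i + r) (2 * j + c) k\<bar> \<le> maxdiff_x A"
    if "r < 3" "c < 2" for r c
    using maxdiff_ge(1)[OF A, of "2 * i + r" "2 * j + c" k] that ijk by simp
  have y: "\<bar>entry A (2 * i + r) (2 * j + 1) k - entry A (2 * i + r) (2 * j) k\<bar> \<le> maxdiff_y A"
    if "r < 4" for r
    using maxdiff_ge(2)[OF A, of "2 * i + r" "2 * j" k] that ijk by simp
  note steps = x[of 0 0] x[of 1 0] x[of 2 0] x[of 0 1] x[of 1 1] x[of 2 1] y[of 0] y[of 1] y[of 2] y[of 3]
  \<comment> \<open>\<open>abs_le_iff\<close> splits an absolute value into two linear inequalities,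
    and \<open>numeral_eq_Suc\<close> puts the indices of both cells into successor form so that
    they match those in \<open>steps\<close>. What remains is linear arithmetic over the eight
    entries.\<close>
  note [simp] = HWT_eqs entry_haar_block[OF A] abs_le_iff numeral_eq_Suc
  show "\<bar>entry (HWT1 A) (i + 1) j k - entry (HWT1 A) i j k\<bar> \<le> 4 * maxdiff_x A"
    using steps ijk by (auto simp: field_simps)
  show "\<bar>entry (HWT2 A) (i + 1) j k - entry (HWT2 A) i j k\<bar> \<le> 2 * min (2 * maxdiff_x A) (maxdiff_y A)"
    using steps ijk by (auto simp: field_simps)
  show "\<bar>entry (HWT3 A) (i + 1) j k - entry (HWT3 A) i j k\<bar> \<le> 2 * maxdiff_x A"
    using steps ijk by (auto simp: field_simps)
  show "\<bar>entry (HWT4 A) (i + 1) j k - entry (HWT4 A) i j k\<bar> \<le> 2 * min (maxdiff_x A) (maxdiff_y A)"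
    using steps ijk by (auto simp: field_simps)
qed

text \<open>The mirror image of the estimates along \<open>x\<close>: the window now has two rows
  and four columns, and \<open>HWT2\<close> and \<open>HWT3\<close> exchange their roles.\<close>

lemma maxdiff_y_HWT_entry_le:
  assumes A: "A \<in> carrier_tensor (2 * m1) (2 * m2) n3" and ijk: "i < m1" "j + 1 < m2" "k < n3"
  shows "\<bar>entry (HWT1 A) i (j + 1) k - entry (HWT1 A) i j k\<bar> \<le> 4 * maxdiff_y A"
    and "\<bar>entry (HWT2 A) i (j + 1) k - entry (HWT2 A) i j k\<bar> \<le> 2 * maxdiff_y A"
    and "\<bar>entry (HWT3 A) i (j + 1) k - entry (HWT3 A) i j k\<bar> \<le> 2 * min (maxdiff_x A) (2 * maxdiff_y A)"
    and "\<bar>entry (HWT4 A) i (j + 1) k - entry (HWT4 A) i j k\<bar> \<le> 2 * min (maxdiff_x A) (maxdiff_y A)"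
proof -
  have x: "\<bar>entry A (2 * i + 1) (2 * j + c) k - entry A (2 * i) (2 * j + c) k\<bar> \<le> maxdiff_x A"
    if "c < 4" for c
    using maxdiff_ge(1)[OF A, of "2 * i" "2 * j + c" k] that ijk by simp
  have y: "\<bar>entry A (2 * i + r) (2 * j + c + 1) k - entry A (2 * i + r) (2 * j + c) k\<bar> \<le> maxdiff_y A"
    if "r < 2" "c < 3" for r c
    using maxdiff_ge(2)[OF A, of "2 * i + r" "2 * j + c" k] that ijk by simp
  note steps = y[of 0 0] y[of 0 1] y[of 0 2] y[of 1 0] y[of 1 1] y[of 1 2] x[of 0] x[of 1] x[of 2] x[of 3]
  note [simp] = HWT_eqs entry_haar_block[OF A] abs_le_iff numeral_eq_Suc
  show "\<bar>entry (HWT1 A) i (j + 1) k - entry (HWT1 A) i j k\<bar> \<le> 4 * maxdiff_y A"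
    using steps ijk by (auto simp: field_simps)
  show "\<bar>entry (HWT2 A) i (j + 1) k - entry (HWT2 A) i j k\<bar> \<le> 2 * maxdiff_y A"
    using steps ijk by (auto simp: field_simps)
  show "\<bar>entry (HWT3 A) i (j + 1) k - entry (HWT3 A) i j k\<bar> \<le> 2 * min (maxdiff_x A) (2 * maxdiff_y A)"
    using steps ijk by (auto simp: field_simps)
  show "\<bar>entry (HWT4 A) i (j + 1) k - entry (HWT4 A) i j k\<bar> \<le> 2 * min (maxdiff_x A) (maxdiff_y A)"
    using steps ijk by (auto simp: field_simps)
qed

text \<open>The same cell is compared in two consecutive slices. Each of its four entries moves by
  one step, so whatever the signs, the difference is at most \<open>4 / 2 = 2\<close> steps.\<close>

lemma maxdiff_z_HWT_entry_le:
  assumes A: "A \<in> carrier_tensor (2 * m1) (2 * m2) n3" and ijk: "i < m1" "j < m2" "k + 1 < n3"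
  shows "\<bar>entry (HWT1 A) i j (k + 1) - entry (HWT1 A) i j k\<bar> \<le> 2 * maxdiff_z A"
    and "\<bar>entry (HWT2 A) i j (k + 1) - entry (HWT2 A) i j k\<bar> \<le> 2 * maxdiff_z A"
    and "\<bar>entry (HWT3 A) i j (k + 1) - entry (HWT3 A) i j k\<bar> \<le> 2 * maxdiff_z A"
    and "\<bar>entry (HWT4 A) i j (k + 1) - entry (HWT4 A) i j k\<bar> \<le> 2 * maxdiff_z A"
proof -
  have z: "\<bar>entry A (2 * i + r) (2 * j + c) (k + 1) - entry A (2 * i + r) (2 * j + c) k\<bar> \<le> maxdiff_z A"
    if "r < 2" "c < 2" for r c
    using maxdiff_ge(3)[OF A, of "2 * i + r" "2 * j + c" k] that ijk by simp
  note steps = z[of 0 0] z[of 0 1] z[of 1 0] z[of 1 1]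
  note [simp] = HWT_eqs entry_haar_block[OF A] abs_le_iff numeral_eq_Suc
  show "\<bar>entry (HWT1 A) i j (k + 1) - entry (HWT1 A) i j k\<bar> \<le> 2 * maxdiff_z A"
    using steps ijk by (auto simp: field_simps)
  show "\<bar>entry (HWT2 A) i j (k + 1) - entry (HWT2 A) i j k\<bar> \<le> 2 * maxdiff_z A"
    using steps ijk by (auto simp: field_simps)
  show "\<bar>entry (HWT3 A) i j (k + 1) - entry (HWT3 A) i j k\<bar> \<le> 2 * maxdiff_z A"
    using steps ijk by (auto simp: field_simps)
  show "\<bar>entry (HWT4 A) i j (k + 1) - entry (HWT4 A) i j k\<bar> \<le> 2 * maxdiff_z A"
    using steps ijk by (auto simp: field_simps)
qed

lemma maxdiff_x_HWT_le:
  assumes "hwt_input n1 n2 n3 A"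
  shows "maxdiff_x (HWT1 A) \<le> 4 * maxdiff_x A"
    and "maxdiff_x (HWT2 A) \<le> 2 * min (2 * maxdiff_x A) (maxdiff_y A)"
    and "maxdiff_x (HWT3 A) \<le> 2 * maxdiff_x A"
    and "maxdiff_x (HWT4 A) \<le> 2 * min (maxdiff_x A) (maxdiff_y A)"
proof -
  obtain m1 m2 where A: "A \<in> carrier_tensor (2 * m1) (2 * m2) n3"
    using assms by (rule hwt_inputE)
  note B = HWT_carrier[OF A]
  show "maxdiff_x (HWT1 A) \<le> 4 * maxdiff_x A"
    \<comment> \<open>Nonnegativity of the bound matters when \<open>m1 = 1\<close>: the block then
      has a single row, and its maximum is 0 by convention.\<close>
    using maxdiff_nonneg[OF A]
    by (intro maxdiff_le(1)[OF B(1)] maxdiff_x_HWT_entry_le(1)[OF A]) auto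
  show "maxdiff_x (HWT2 A) \<le> 2 * min (2 * maxdiff_x A) (maxdiff_y A)"
    using maxdiff_nonneg[OF A]
    by (intro maxdiff_le(1)[OF B(2)] maxdiff_x_HWT_entry_le(2)[OF A]) auto
  show "maxdiff_x (HWT3 A) \<le> 2 * maxdiff_x A"
    using maxdiff_nonneg[OF A]
    by (intro maxdiff_le(1)[OF B(3)] maxdiff_x_HWT_entry_le(3)[OF A]) auto
  show "maxdiff_x (HWT4 A) \<le> 2 * min (maxdiff_x A) (maxdiff_y A)"
    using maxdiff_nonneg[OF A]
    by (intro maxdiff_le(1)[OF B(4)] maxdiff_x_HWT_entry_le(4)[OF A]) auto
qed

lemma maxdiff_y_HWT_le:
  assumes "hwt_input n1 n2 n3 A"
  shows "maxdiff_y (HWT1 A) \<le> 4 * maxdiff_y A"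
    and "maxdiff_y (HWT2 A) \<le> 2 * maxdiff_y A"
    and "maxdiff_y (HWT3 A) \<le> 2 * min (maxdiff_x A) (2 * maxdiff_y A)"
    and "maxdiff_y (HWT4 A) \<le> 2 * min (maxdiff_x A) (maxdiff_y A)"
proof -
  obtain m1 m2 where A: "A \<in> carrier_tensor (2 * m1) (2 * m2) n3"
    using assms by (rule hwt_inputE)
  note B = HWT_carrier[OF A]
  show "maxdiff_y (HWT1 A) \<le> 4 * maxdiff_y A"
    using maxdiff_nonneg[OF A]
    by (intro maxdiff_le(2)[OF B(1)] maxdiff_y_HWT_entry_le(1)[OF A]) auto
  show "maxdiff_y (HWT2 A) \<le> 2 * maxdiff_y A"
    using maxdiff_nonneg[OF A]
    by (intro maxdiff_le(2)[OF B(2)] maxdiff_y_HWT_entry_le(2)[OF A]) auto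
  show "maxdiff_y (HWT3 A) \<le> 2 * min (maxdiff_x A) (2 * maxdiff_y A)"
    using maxdiff_nonneg[OF A]
    by (intro maxdiff_le(2)[OF B(3)] maxdiff_y_HWT_entry_le(3)[OF A]) auto
  show "maxdiff_y (HWT4 A) \<le> 2 * min (maxdiff_x A) (maxdiff_y A)"
    using maxdiff_nonneg[OF A]
    by (intro maxdiff_le(2)[OF B(4)] maxdiff_y_HWT_entry_le(4)[OF A]) auto
qed

lemma maxdiff_z_HWT_le:
  assumes "hwt_input n1 n2 n3 A"
  shows "maxdiff_z (HWT1 A) \<le> 2 * maxdiff_z A"
    and "maxdiff_z (HWT2 A) \<le> 2 * maxdiff_z A"
    and "maxdiff_z (HWT3 A) \<le> 2 * maxdiff_z A"
    and "maxdiff_z (HWT4 A) \<le> 2 * maxdiff_z A"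
proof -
  obtain m1 m2 where A: "A \<in> carrier_tensor (2 * m1) (2 * m2) n3"
    using assms by (rule hwt_inputE)
  note B = HWT_carrier[OF A]
  show "maxdiff_z (HWT1 A) \<le> 2 * maxdiff_z A"
    using maxdiff_nonneg[OF A]
    by (intro maxdiff_le(3)[OF B(1)] maxdiff_z_HWT_entry_le(1)[OF A]) auto
  show "maxdiff_z (HWT2 A) \<le> 2 * maxdiff_z A"
    using maxdiff_nonneg[OF A]
    by (intro maxdiff_le(3)[OF B(2)] maxdiff_z_HWT_entry_le(2)[OF A]) auto
  show "maxdiff_z (HWT3 A) \<le> 2 * maxdiff_z A"
    using maxdiff_nonneg[OF A]
    by (intro maxdiff_le(3)[OF B(3)] maxdiff_z_HWT_entry_le(3)[OF A]) auto
  show "maxdiff_z (HWT4 A) \<le> 2 * maxdiff_z A"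
    using maxdiff_nonneg[OF A]
    by (intro maxdiff_le(3)[OF B(4)] maxdiff_z_HWT_entry_le(4)[OF A]) auto
qed

section \<open>Tensors that attain the bounds\<close>

definition tensor_of :: "nat \<Rightarrow> nat \<Rightarrow> nat \<Rightarrow> (nat \<Rightarrow> nat \<Rightarrow> nat \<Rightarrow> real) \<Rightarrow> tensor" where
  "tensor_of n1 n2 n3 f = map (\<lambda>k. mat n1 n2 (\<lambda>(i, j). f i j k)) [0..<n3]"

lemma tensor_of_carrier: "tensor_of n1 n2 n3 f \<in> carrier_tensor n1 n2 n3"
  by (auto simp: tensor_of_def carrier_tensor_def)

lemma entry_tensor_of:
  assumes "i < n1" and "j < n2" and "k < n3"
  shows "entry (tensor_of n1 n2 n3 f) i j k = f i j k"
  using assms by (simp add: tensor_of_def entry_def)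

text \<open>A linear ramp makes all steps along \<open>x\<close> equal to 1 with the same sign, so
  nothing cancels between the two cells: the block entries are 1 and 5. The size is the smallest for
  which a block has a difference along \<open>x\<close>.\<close>

lemma maxdiff_x_HWT1_sharp:
  "\<exists>A. hwt_input 4 2 1 A \<and> maxdiff_x (HWT1 A) = 4 * maxdiff_x A \<and> 0 < maxdiff_x (HWT1 A)"
proof -
  define A where "A = tensor_of 4 2 1 (\<lambda>i j k. real i)"
  have A: "A \<in> carrier_tensor 4 2 1"
    unfolding A_def by (rule tensor_of_carrier)
  have input: "hwt_input 4 2 1 A"
    using A by (simp add: hwt_input_def)
  have "maxdiff_x A \<le> 1"
    by (rule maxdiff_le(1)[OF A]) (auto simp: A_def entry_tensor_of)
  moreover have "4 \<le> maxdiff_x (HWT1 A)"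
  proof -
    have A': "A \<in> carrier_tensor (2 * 2) (2 * 1) 1"
      using A by simp
    have "\<bar>entry (HWT1 A) (0 + 1) 0 0 - entry (HWT1 A) 0 0 0\<bar> = 4"
      by (simp add: HWT_eqs entry_haar_block[OF A']) (simp add: A_def entry_tensor_of)
    then show ?thesis
      using maxdiff_ge(1)[OF HWT_carrier(1)[OF A'], of 0 0 0] by simp
  qed
  ultimately show ?thesis
    \<comment> \<open>Squeeze: the general bound gives
      \<open>maxdiff_x (HWT1 A) \<le> 4 * maxdiff_x A \<le> 4\<close>, and the lower bound 4 forces
      equality. The remaining witnesses are treated in the same way.\<close>
    using input maxdiff_x_HWT_le(1)[OF input] by (intro exI[of _ A] conjI; (assumption | linarith))
qed

lemma maxdiff_x_HWT2_sharp:
  "\<exists>A. hwt_input 4 2 1 A \<and> maxdiff_x (HWT2 A) = 2 * min (2 * maxdiff_x A) (maxdiff_y A) \<and> 0 < maxdiff_x (HWT2 A)"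
proof -
  \<comment> \<open>Each cell carries the sign pattern of \<open>HWT2\<close>, reversed in the
    second cell, so the block entries are 1 and -1. The factor one half makes the steps along
    \<open>y\<close> equal to 1, which bounds the minimum by 1.\<close>
  define A where "A = tensor_of 4 2 1 (\<lambda>i j k. (if i < 2 then 1 else - 1) * (- 1) ^ j / 2)"
  have A: "A \<in> carrier_tensor 4 2 1"
    unfolding A_def by (rule tensor_of_carrier)
  have input: "hwt_input 4 2 1 A"
    using A by (simp add: hwt_input_def)
  have "maxdiff_y A \<le> 1"
    by (rule maxdiff_le(2)[OF A]) (auto simp: A_def entry_tensor_of)
  moreover have "2 \<le> maxdiff_x (HWT2 A)"
  proof -
    have A': "A \<in> carrier_tensor (2 * 2) (2 * 1) 1"
      using A by simp
    have "\<bar>entry (HWT2 A) (0 + 1) 0 0 - entry (HWT2 A) 0 0 0\<bar> = 2"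
      by (simp add: HWT_eqs entry_haar_block[OF A']) (simp add: A_def entry_tensor_of)
    then show ?thesis
      using maxdiff_ge(1)[OF HWT_carrier(2)[OF A'], of 0 0 0] by simp
  qed
  ultimately show ?thesis
    using input maxdiff_x_HWT_le(2)[OF input] by (intro exI[of _ A] conjI; (assumption | linarith))
qed

lemma maxdiff_x_HWT3_sharp:
  "\<exists>A. hwt_input 4 2 1 A \<and> maxdiff_x (HWT3 A) = 2 * maxdiff_x A \<and> 0 < maxdiff_x (HWT3 A)"
proof -
  \<comment> \<open>The rows are 0, 1, 1, 0: up by one in the first cell and down by one in the
    second, so the block entries are -1 and 1.\<close>
  define A where "A = tensor_of 4 2 1 (\<lambda>i j k. if i = 1 \<or> i = 2 then 1 else 0)"
  have A: "A \<in> carrier_tensor 4 2 1"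
    unfolding A_def by (rule tensor_of_carrier)
  have input: "hwt_input 4 2 1 A"
    using A by (simp add: hwt_input_def)
  have "maxdiff_x A \<le> 1"
    by (rule maxdiff_le(1)[OF A]) (auto simp: A_def entry_tensor_of)
  moreover have "2 \<le> maxdiff_x (HWT3 A)"
  proof -
    have A': "A \<in> carrier_tensor (2 * 2) (2 * 1) 1"
      using A by simp
    have "\<bar>entry (HWT3 A) (0 + 1) 0 0 - entry (HWT3 A) 0 0 0\<bar> = 2"
      by (simp add: HWT_eqs entry_haar_block[OF A']) (simp add: A_def entry_tensor_of)
    then show ?thesis
      using maxdiff_ge(1)[OF HWT_carrier(3)[OF A'], of 0 0 0] by simp
  qed
  ultimately show ?thesis
    using input maxdiff_x_HWT_le(3)[OF input] by (intro exI[of _ A] conjI; (assumption | linarith))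
qed

lemma maxdiff_x_HWT4_sharp:
  "\<exists>A. hwt_input 4 2 1 A \<and> maxdiff_x (HWT4 A) = 2 * min (maxdiff_x A) (maxdiff_y A) \<and> 0 < maxdiff_x (HWT4 A)"
proof -
  \<comment> \<open>Row signs -, +, +, - combined with alternation along \<open>y\<close> give the
    checkerboard of \<open>HWT4\<close> with opposite signs in the two cells. The block entries are
    -1 and 1, while no step of \<open>A\<close> exceeds 1.\<close>
  define A where "A = tensor_of 4 2 1 (\<lambda>i j k. (if i = 1 \<or> i = 2 then 1 else - 1) * (- 1) ^ j / 2)"
  have A: "A \<in> carrier_tensor 4 2 1"
    unfolding A_def by (rule tensor_of_carrier)
  have input: "hwt_input 4 2 1 A"
    using A by (simp add: hwt_input_def)
  have "maxdiff_x A \<le> 1"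
    by (rule maxdiff_le(1)[OF A]) (auto simp: A_def entry_tensor_of)
  moreover have "2 \<le> maxdiff_x (HWT4 A)"
  proof -
    have A': "A \<in> carrier_tensor (2 * 2) (2 * 1) 1"
      using A by simp
    have "\<bar>entry (HWT4 A) (0 + 1) 0 0 - entry (HWT4 A) 0 0 0\<bar> = 2"
      by (simp add: HWT_eqs entry_haar_block[OF A']) (simp add: A_def entry_tensor_of)
    then show ?thesis
      using maxdiff_ge(1)[OF HWT_carrier(4)[OF A'], of 0 0 0] by simp
  qed
  ultimately show ?thesis
    using input maxdiff_x_HWT_le(4)[OF input] by (intro exI[of _ A] conjI; (assumption | linarith))
qed

text \<open>The witnesses along \<open>y\<close> are those along \<open>x\<close> with
  \<open>i\<close> and \<open>j\<close> interchanged; accordingly the ones for \<open>HWT2\<close>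
  and \<open>HWT3\<close> swap places.\<close>

lemma maxdiff_y_HWT1_sharp:
  "\<exists>A. hwt_input 2 4 1 A \<and> maxdiff_y (HWT1 A) = 4 * maxdiff_y A \<and> 0 < maxdiff_y (HWT1 A)"
proof -
  define A where "A = tensor_of 2 4 1 (\<lambda>i j k. real j)"
  have A: "A \<in> carrier_tensor 2 4 1"
    unfolding A_def by (rule tensor_of_carrier)
  have input: "hwt_input 2 4 1 A"
    using A by (simp add: hwt_input_def)
  have "maxdiff_y A \<le> 1"
    by (rule maxdiff_le(2)[OF A]) (auto simp: A_def entry_tensor_of)
  moreover have "4 \<le> maxdiff_y (HWT1 A)"
  proof -
    have A': "A \<in> carrier_tensor (2 * 1) (2 * 2) 1"
      using A by simp
    have "\<bar>entry (HWT1 A) 0 (0 + 1) 0 - entry (HWT1 A) 0 0 0\<bar> = 4"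
      by (simp add: HWT_eqs entry_haar_block[OF A']) (simp add: A_def entry_tensor_of)
    then show ?thesis
      using maxdiff_ge(2)[OF HWT_carrier(1)[OF A'], of 0 0 0] by simp
  qed
  ultimately show ?thesis
    using input maxdiff_y_HWT_le(1)[OF input] by (intro exI[of _ A] conjI; (assumption | linarith))
qed

lemma maxdiff_y_HWT2_sharp:
  "\<exists>A. hwt_input 2 4 1 A \<and> maxdiff_y (HWT2 A) = 2 * maxdiff_y A \<and> 0 < maxdiff_y (HWT2 A)"
proof -
  define A where "A = tensor_of 2 4 1 (\<lambda>i j k. if j = 1 \<or> j = 2 then 1 else 0)"
  have A: "A \<in> carrier_tensor 2 4 1"
    unfolding A_def by (rule tensor_of_carrier)
  have input: "hwt_input 2 4 1 A"
    using A by (simp add: hwt_input_def)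
  have "maxdiff_y A \<le> 1"
    by (rule maxdiff_le(2)[OF A]) (auto simp: A_def entry_tensor_of)
  moreover have "2 \<le> maxdiff_y (HWT2 A)"
  proof -
    have A': "A \<in> carrier_tensor (2 * 1) (2 * 2) 1"
      using A by simp
    have "\<bar>entry (HWT2 A) 0 (0 + 1) 0 - entry (HWT2 A) 0 0 0\<bar> = 2"
      by (simp add: HWT_eqs entry_haar_block[OF A']) (simp add: A_def entry_tensor_of)
    then show ?thesis
      using maxdiff_ge(2)[OF HWT_carrier(2)[OF A'], of 0 0 0] by simp
  qed
  ultimately show ?thesis
    using input maxdiff_y_HWT_le(2)[OF input] by (intro exI[of _ A] conjI; (assumption | linarith))
qed

lemma maxdiff_y_HWT3_sharp:
  "\<exists>A. hwt_input 2 4 1 A \<and> maxdiff_y (HWT3 A) = 2 * min (maxdiff_x A) (2 * maxdiff_y A) \<and> 0 < maxdiff_y (HWT3 A)"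
proof -
  define A where "A = tensor_of 2 4 1 (\<lambda>i j k. (if j < 2 then 1 else - 1) * (- 1) ^ i / 2)"
  have A: "A \<in> carrier_tensor 2 4 1"
    unfolding A_def by (rule tensor_of_carrier)
  have input: "hwt_input 2 4 1 A"
    using A by (simp add: hwt_input_def)
  have "maxdiff_x A \<le> 1"
    by (rule maxdiff_le(1)[OF A]) (auto simp: A_def entry_tensor_of)
  moreover have "2 \<le> maxdiff_y (HWT3 A)"
  proof -
    have A': "A \<in> carrier_tensor (2 * 1) (2 * 2) 1"
      using A by simp
    have "\<bar>entry (HWT3 A) 0 (0 + 1) 0 - entry (HWT3 A) 0 0 0\<bar> = 2"
      by (simp add: HWT_eqs entry_haar_block[OF A']) (simp add: A_def entry_tensor_of)
    then show ?thesis
      using maxdiff_ge(2)[OF HWT_carrier(3)[OF A'], of 0 0 0] by simp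
  qed
  ultimately show ?thesis
    using input maxdiff_y_HWT_le(3)[OF input] by (intro exI[of _ A] conjI; (assumption | linarith))
qed

lemma maxdiff_y_HWT4_sharp:
  "\<exists>A. hwt_input 2 4 1 A \<and> maxdiff_y (HWT4 A) = 2 * min (maxdiff_x A) (maxdiff_y A) \<and> 0 < maxdiff_y (HWT4 A)"
proof -
  define A where "A = tensor_of 2 4 1 (\<lambda>i j k. (if j = 1 \<or> j = 2 then 1 else - 1) * (- 1) ^ i / 2)"
  have A: "A \<in> carrier_tensor 2 4 1"
    unfolding A_def by (rule tensor_of_carrier)
  have input: "hwt_input 2 4 1 A"
    using A by (simp add: hwt_input_def)
  have "maxdiff_x A \<le> 1"
    by (rule maxdiff_le(1)[OF A]) (auto simp: A_def entry_tensor_of)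
  moreover have "2 \<le> maxdiff_y (HWT4 A)"
  proof -
    have A': "A \<in> carrier_tensor (2 * 1) (2 * 2) 1"
      using A by simp
    have "\<bar>entry (HWT4 A) 0 (0 + 1) 0 - entry (HWT4 A) 0 0 0\<bar> = 2"
      by (simp add: HWT_eqs entry_haar_block[OF A']) (simp add: A_def entry_tensor_of)
    then show ?thesis
      using maxdiff_ge(2)[OF HWT_carrier(4)[OF A'], of 0 0 0] by simp
  qed
  ultimately show ?thesis
    using input maxdiff_y_HWT_le(4)[OF input] by (intro exI[of _ A] conjI; (assumption | linarith))
qed

text \<open>For each bound along \<open>z\<close>, the first slice is zero and the second is the
  sign pattern of the block in question. All four terms of the cell then add up to 4, so the block
  entry moves from 0 to 2 while every entry of \<open>A\<close> moves by 1.\<close>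

lemma maxdiff_z_HWT1_sharp:
  "\<exists>A. hwt_input 2 2 2 A \<and> maxdiff_z (HWT1 A) = 2 * maxdiff_z A \<and> 0 < maxdiff_z (HWT1 A)"
proof -
  define A where "A = tensor_of 2 2 2 (\<lambda>i j k. real k)"
  have A: "A \<in> carrier_tensor 2 2 2"
    unfolding A_def by (rule tensor_of_carrier)
  have input: "hwt_input 2 2 2 A"
    using A by (simp add: hwt_input_def)
  have "maxdiff_z A \<le> 1"
    by (rule maxdiff_le(3)[OF A]) (auto simp: A_def entry_tensor_of)
  moreover have "2 \<le> maxdiff_z (HWT1 A)"
  proof -
    have A': "A \<in> carrier_tensor (2 * 1) (2 * 1) 2"
      using A by simp
    have "\<bar>entry (HWT1 A) 0 0 (0 + 1) - entry (HWT1 A) 0 0 0\<bar> = 2"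
      by (simp add: HWT_eqs entry_haar_block[OF A']) (simp add: A_def entry_tensor_of)
    then show ?thesis
      using maxdiff_ge(3)[OF HWT_carrier(1)[OF A'], of 0 0 0] by simp
  qed
  ultimately show ?thesis
    using input maxdiff_z_HWT_le(1)[OF input] by (intro exI[of _ A] conjI; (assumption | linarith))
qed

lemma maxdiff_z_HWT2_sharp:
  "\<exists>A. hwt_input 2 2 2 A \<and> maxdiff_z (HWT2 A) = 2 * maxdiff_z A \<and> 0 < maxdiff_z (HWT2 A)"
proof -
  define A where "A = tensor_of 2 2 2 (\<lambda>i j k. real k * (- 1) ^ j)"
  have A: "A \<in> carrier_tensor 2 2 2"
    unfolding A_def by (rule tensor_of_carrier)
  have input: "hwt_input 2 2 2 A"
    using A by (simp add: hwt_input_def)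
  have "maxdiff_z A \<le> 1"
    by (rule maxdiff_le(3)[OF A]) (auto simp: A_def entry_tensor_of)
  moreover have "2 \<le> maxdiff_z (HWT2 A)"
  proof -
    have A': "A \<in> carrier_tensor (2 * 1) (2 * 1) 2"
      using A by simp
    have "\<bar>entry (HWT2 A) 0 0 (0 + 1) - entry (HWT2 A) 0 0 0\<bar> = 2"
      by (simp add: HWT_eqs entry_haar_block[OF A']) (simp add: A_def entry_tensor_of)
    then show ?thesis
      using maxdiff_ge(3)[OF HWT_carrier(2)[OF A'], of 0 0 0] by simp
  qed
  ultimately show ?thesis
    using input maxdiff_z_HWT_le(2)[OF input] by (intro exI[of _ A] conjI; (assumption | linarith))
qed

lemma maxdiff_z_HWT3_sharp:
  "\<exists>A. hwt_input 2 2 2 A \<and> maxdiff_z (HWT3 A) = 2 * maxdiff_z A \<and> 0 < maxdiff_z (HWT3 A)"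
proof -
  define A where "A = tensor_of 2 2 2 (\<lambda>i j k. real k * (- 1) ^ i)"
  have A: "A \<in> carrier_tensor 2 2 2"
    unfolding A_def by (rule tensor_of_carrier)
  have input: "hwt_input 2 2 2 A"
    using A by (simp add: hwt_input_def)
  have "maxdiff_z A \<le> 1"
    by (rule maxdiff_le(3)[OF A]) (auto simp: A_def entry_tensor_of)
  moreover have "2 \<le> maxdiff_z (HWT3 A)"
  proof -
    have A': "A \<in> carrier_tensor (2 * 1) (2 * 1) 2"
      using A by simp
    have "\<bar>entry (HWT3 A) 0 0 (0 + 1) - entry (HWT3 A) 0 0 0\<bar> = 2"
      by (simp add: HWT_eqs entry_haar_block[OF A']) (simp add: A_def entry_tensor_of)
    then show ?thesis
      using maxdiff_ge(3)[OF HWT_carrier(3)[OF A'], of 0 0 0] by simp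
  qed
  ultimately show ?thesis
    using input maxdiff_z_HWT_le(3)[OF input] by (intro exI[of _ A] conjI; (assumption | linarith))
qed

lemma maxdiff_z_HWT4_sharp:
  "\<exists>A. hwt_input 2 2 2 A \<and> maxdiff_z (HWT4 A) = 2 * maxdiff_z A \<and> 0 < maxdiff_z (HWT4 A)"
proof -
  define A where "A = tensor_of 2 2 2 (\<lambda>i j k. real k * (- 1) ^ (i + j))"
  have A: "A \<in> carrier_tensor 2 2 2"
    unfolding A_def by (rule tensor_of_carrier)
  have input: "hwt_input 2 2 2 A"
    using A by (simp add: hwt_input_def)
  have "maxdiff_z A \<le> 1"
    by (rule maxdiff_le(3)[OF A]) (auto simp: A_def entry_tensor_of)
  moreover have "2 \<le> maxdiff_z (HWT4 A)"
  proof -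
    have A': "A \<in> carrier_tensor (2 * 1) (2 * 1) 2"
      using A by simp
    have "\<bar>entry (HWT4 A) 0 0 (0 + 1) - entry (HWT4 A) 0 0 0\<bar> = 2"
      by (simp add: HWT_eqs entry_haar_block[OF A']) (simp add: A_def entry_tensor_of)
    then show ?thesis
      using maxdiff_ge(3)[OF HWT_carrier(4)[OF A'], of 0 0 0] by simp
  qed
  ultimately show ?thesis
    using input maxdiff_z_HWT_le(4)[OF input] by (intro exI[of _ A] conjI; (assumption | linarith))
qed

section \<open>From attained bounds to optimality\<close>

lemma idx_nonempty:
  "0 < maxdiff_x B \<Longrightarrow> idx_x B \<noteq> {}"
  "0 < maxdiff_y B \<Longrightarrow> idx_y B \<noteq> {}"
  "0 < maxdiff_z B \<Longrightarrow> idx_z B \<noteq> {}"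
  \<comment> \<open>An empty index set would give the value 0, so a positive value certifies a
    genuine maximum.\<close>
  by (auto simp: maxdiff_x_def maxdiff_y_def maxdiff_z_def max_over_def)

text \<open>A tensor that attains the bound exactly serves every \<open>\<epsilon>\<close> at once;
  \<open>f\<close> stands for the left-hand side, \<open>g\<close> for the bound and
  \<open>I\<close> for the index set of the maximum.\<close>

lemma sharpE:
  fixes \<epsilon> :: real
  assumes "\<exists>A. hwt_input n1 n2 n3 A \<and> f A = g A \<and> 0 < f A" and "0 < \<epsilon>"
    and "\<And>A. 0 < f A \<Longrightarrow> I A \<noteq> {}"
  shows "\<exists>n1 n2 n3 A. hwt_input n1 n2 n3 A \<and> I A \<noteq> {} \<and> f A > g A - \<epsilon>"
proof -
  obtain A where "hwt_input n1 n2 n3 A" "f A = g A" "0 < f A"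
    using assms(1) by blast
  moreover from this have "I A \<noteq> {}" "f A > g A - \<epsilon>"
    using assms(2,3) by auto
  ultimately show ?thesis by blast
qed

theorem theorem5:
  "(\<forall>n1 n2 n3 A L1 L2 L3. hwt_input n1 n2 n3 A \<longrightarrow>
      L1 = maxdiff_x A \<longrightarrow> L2 = maxdiff_y A \<longrightarrow> L3 = maxdiff_z A \<longrightarrow>
       maxdiff_x (HWT1 A) \<le> 4 * L1 \<and>
       maxdiff_x (HWT2 A) \<le> 2 * min (2 * L1) L2 \<and>
       maxdiff_x (HWT3 A) \<le> 2 * L1 \<and>
       maxdiff_x (HWT4 A) \<le> 2 * min L1 L2 \<and>
       maxdiff_y (HWT1 A) \<le> 4 * L2 \<and>
       maxdiff_y (HWT2 A) \<le> 2 * L2 \<and>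
       maxdiff_y (HWT3 A) \<le> 2 * min L1 (2 * L2) \<and>
       maxdiff_y (HWT4 A) \<le> 2 * min L1 L2 \<and>
       maxdiff_z (HWT1 A) \<le> 2 * L3 \<and>
       maxdiff_z (HWT2 A) \<le> 2 * L3 \<and>
       maxdiff_z (HWT3 A) \<le> 2 * L3 \<and>
       maxdiff_z (HWT4 A) \<le> 2 * L3) \<and>
   (\<forall>\<epsilon>>0.
      (\<exists>n1 n2 n3 A. hwt_input n1 n2 n3 A \<and> idx_x (HWT1 A) \<noteq> {} \<and>
         maxdiff_x (HWT1 A) > 4 * maxdiff_x A - \<epsilon>) \<and>
      (\<exists>n1 n2 n3 A. hwt_input n1 n2 n3 A \<and> idx_x (HWT2 A) \<noteq> {} \<and>
         maxdiff_x (HWT2 A) > 2 * min (2 * maxdiff_x A) (maxdiff_y A) - \<epsilon>) \<and>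
      (\<exists>n1 n2 n3 A. hwt_input n1 n2 n3 A \<and> idx_x (HWT3 A) \<noteq> {} \<and>
         maxdiff_x (HWT3 A) > 2 * maxdiff_x A - \<epsilon>) \<and>
      (\<exists>n1 n2 n3 A. hwt_input n1 n2 n3 A \<and> idx_x (HWT4 A) \<noteq> {} \<and>
         maxdiff_x (HWT4 A) > 2 * min (maxdiff_x A) (maxdiff_y A) - \<epsilon>) \<and>
      (\<exists>n1 n2 n3 A. hwt_input n1 n2 n3 A \<and> idx_y (HWT1 A) \<noteq> {} \<and>
         maxdiff_y (HWT1 A) > 4 * maxdiff_y A - \<epsilon>) \<and>
      (\<exists>n1 n2 n3 A. hwt_input n1 n2 n3 A \<and> idx_y (HWT2 A) \<noteq> {} \<and>
         maxdiff_y (HWT2 A) > 2 * maxdiff_y A - \<epsilon>) \<and>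
      (\<exists>n1 n2 n3 A. hwt_input n1 n2 n3 A \<and> idx_y (HWT3 A) \<noteq> {} \<and>
         maxdiff_y (HWT3 A) > 2 * min (maxdiff_x A) (2 * maxdiff_y A) - \<epsilon>) \<and>
      (\<exists>n1 n2 n3 A. hwt_input n1 n2 n3 A \<and> idx_y (HWT4 A) \<noteq> {} \<and>
         maxdiff_y (HWT4 A) > 2 * min (maxdiff_x A) (maxdiff_y A) - \<epsilon>) \<and>
      (\<exists>n1 n2 n3 A. hwt_input n1 n2 n3 A \<and> idx_z (HWT1 A) \<noteq> {} \<and>
         maxdiff_z (HWT1 A) > 2 * maxdiff_z A - \<epsilon>) \<and>
      (\<exists>n1 n2 n3 A. hwt_input n1 n2 n3 A \<and> idx_z (HWT2 A) \<noteq> {} \<and>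
         maxdiff_z (HWT2 A) > 2 * maxdiff_z A - \<epsilon>) \<and>
      (\<exists>n1 n2 n3 A. hwt_input n1 n2 n3 A \<and> idx_z (HWT3 A) \<noteq> {} \<and>
         maxdiff_z (HWT3 A) > 2 * maxdiff_z A - \<epsilon>) \<and>
      (\<exists>n1 n2 n3 A. hwt_input n1 n2 n3 A \<and> idx_z (HWT4 A) \<noteq> {} \<and>
         maxdiff_z (HWT4 A) > 2 * maxdiff_z A - \<epsilon>))"
proof (intro conjI allI impI, goal_cases)
  case 1
  then show ?case using maxdiff_x_HWT_le(1) by simp
next
  case 2
  then show ?case using maxdiff_x_HWT_le(2) by simp
next
  case 3
  then show ?case using maxdiff_x_HWT_le(3) by simp
next
  case 4
  then show ?case using maxdiff_x_HWT_le(4) by simp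
next
  case 5
  then show ?case using maxdiff_y_HWT_le(1) by simp
next
  case 6
  then show ?case using maxdiff_y_HWT_le(2) by simp
next
  case 7
  then show ?case using maxdiff_y_HWT_le(3) by simp
next
  case 8
  then show ?case using maxdiff_y_HWT_le(4) by simp
next
  case 9
  then show ?case using maxdiff_z_HWT_le(1) by simp
next
  case 10
  then show ?case using maxdiff_z_HWT_le(2) by simp
next
  case 11
  then show ?case using maxdiff_z_HWT_le(3) by simp
next
  case 12
  then show ?case using maxdiff_z_HWT_le(4) by simp
next
  \<comment> \<open>The upper bounds are settled; the remaining goals are the optimality claims,
    each with the demand that the maximum on the left be over a nonempty set.\<close>
  case (13 \<epsilon>)
  then show ?case by (intro sharpE[OF maxdiff_x_HWT1_sharp] idx_nonempty(1))
next
  case (14 \<epsilon>)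
  then show ?case by (intro sharpE[OF maxdiff_x_HWT2_sharp] idx_nonempty(1))
next
  case (15 \<epsilon>)
  then show ?case by (intro sharpE[OF maxdiff_x_HWT3_sharp] idx_nonempty(1))
next
  case (16 \<epsilon>)
  then show ?case by (intro sharpE[OF maxdiff_x_HWT4_sharp] idx_nonempty(1))
next
  case (17 \<epsilon>)
  then show ?case by (intro sharpE[OF maxdiff_y_HWT1_sharp] idx_nonempty(2))
next
  case (18 \<epsilon>)
  then show ?case by (intro sharpE[OF maxdiff_y_HWT2_sharp] idx_nonempty(2))
next
  case (19 \<epsilon>)
  then show ?case by (intro sharpE[OF maxdiff_y_HWT3_sharp] idx_nonempty(2))
next
  case (20 \<epsilon>)
  then show ?case by (intro sharpE[OF maxdiff_y_HWT4_sharp] idx_nonempty(2))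
next
  case (21 \<epsilon>)
  then show ?case by (intro sharpE[OF maxdiff_z_HWT1_sharp] idx_nonempty(3))
next
  case (22 \<epsilon>)
  then show ?case by (intro sharpE[OF maxdiff_z_HWT2_sharp] idx_nonempty(3))
next
  case (23 \<epsilon>)
  then show ?case by (intro sharpE[OF maxdiff_z_HWT3_sharp] idx_nonempty(3))
next
  case (24 \<epsilon>)
  then show ?case by (intro sharpE[OF maxdiff_z_HWT4_sharp] idx_nonempty(3))
qed

end
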